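(* Let $X\in\mathbb{R}^{n\times n}_+$ and let $\mathbf u,\mathbf v\in\mathbb{R}^n_+$. Then $$\mathcal{P}_{sk}(X)=\mathcal{P}_{sk}\big(X\circ(\mathbf u\otimes\mathbf v^T)\big).$$
   Context: $\mathbb{R}^{n\times n}_+$ (resp. $\mathbb{R}^n_+$) denotes the real $n\times n$ matrices (resp. $n$-vectors) with all entries strictly positive. For a vector $\mathbf{x}$, $D_{(\mathbf{x})}$ is the diagonal matrix with diagonal $\mathbf{x}$. A matrix is doubly stochastic if it is entrywise nonnegative with all row sums and all column sums equal to $1$. $\circ$ is the Hadamard (entrywise) product. For vectors $\mathbf u,\mathbf v\in\mathbb{R}^n$, $\mathbf u\otimes\mathbf v^T$ is the $n\times n$ matrix with entries $(\mathbf u\otimes\mathbf v^T)_{ij}=u_iv_j$. Sinkhorn operator: for $Y\in\mathbb{R}^{n\times n}_+$, $\mathcal{P}_{sk}(Y)=D_{(\mathbf r)}YD_{(\mathbf c)}$, where $\mathbf r,\mathbf c\in\mathbb{R}^n_+$ are balancing vectors, i.e. such that $D_{(\mathbf r)}YD_{(\mathbf c)}$ is doubly stochastic (by Sinkhorn's theorem such vectors exist and the resulting doubly stochastic matrix is unique). *)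

theory Defs
  imports "HOL-Analysis.Analysis"
begin

definition pos_vector :: "real ^ 'n \<Rightarrow> bool" where
  "pos_vector x \<longleftrightarrow> (\<forall>i. 0 < x $ i)"

definition pos_matrix :: "real ^ 'n ^ 'm \<Rightarrow> bool" where
  "pos_matrix A \<longleftrightarrow> (\<forall>i j. 0 < A $ i $ j)"

definition diag_matrix :: "real ^ 'n \<Rightarrow> real ^ 'n ^ 'n" where
  "diag_matrix x = (\<chi> i j. if i = j then x $ i else 0)"

definition doubly_stochastic :: "real ^ 'n ^ 'n \<Rightarrow> bool" where
  "doubly_stochastic A \<longleftrightarrow>
     (\<forall>i j. 0 \<le> A $ i $ j) \<and>
     (\<forall>i. (\<Sum>j\<in>UNIV. A $ i $ j) = 1) \<and>
     (\<forall>j. (\<Sum>i\<in>UNIV. A $ i $ j) = 1)"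

definition hadamard_product :: "real ^ 'n ^ 'm \<Rightarrow> real ^ 'n ^ 'm \<Rightarrow> real ^ 'n ^ 'm"
    (infixl \<open>\<circ>\<^sub>H\<close> 70) where
  "A \<circ>\<^sub>H B = (\<chi> i j. A $ i $ j * B $ i $ j)"

definition outer_product :: "real ^ 'm \<Rightarrow> real ^ 'n \<Rightarrow> real ^ 'n ^ 'm"
    (infixl \<open>\<otimes>\<^sub>v\<close> 75) where
  "u \<otimes>\<^sub>v v = (\<chi> i j. u $ i * v $ j)"

definition balancing :: "real ^ 'n ^ 'n \<Rightarrow> real ^ 'n \<Rightarrow> real ^ 'n \<Rightarrow> bool" where
  "balancing Y r c \<longleftrightarrow>
     pos_vector r \<and> pos_vector c \<and>
     doubly_stochastic (diag_matrix r ** Y ** diag_matrix c)"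

text \<open>
  Balancing vectors are determined only up to a scalar, but the balanced matrix is unique; the
  description is well defined on entrywise positive matrices by Sinkhorn's theorem, proved
  below. On other matrices its value is irrelevant.
\<close>

definition sinkhorn :: "real ^ 'n ^ 'n \<Rightarrow> real ^ 'n ^ 'n" where
  "sinkhorn Y =
     (THE M. \<exists>r c. balancing Y r c \<and> M = diag_matrix r ** Y ** diag_matrix c)"

lemma diag_matrix_scaling_nth:
  "(diag_matrix r ** Y ** diag_matrix c) $ i $ j = r $ i * Y $ i $ j * c $ j"
  by (simp add: diag_matrix_def matrix_matrix_mult_def if_distrib if_distribR
      cong: if_cong)

lemma balancing_iff:
  assumes "pos_matrix Y"
  shows "balancing Y r c \<longleftrightarrow> pos_vector r \<and> pos_vector c \<and>
    (\<forall>i. r $ i * (\<Sum>j\<in>UNIV. Y $ i $ j * c $ j) = 1) \<and>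
    (\<forall>j. c $ j * (\<Sum>i\<in>UNIV. Y $ i $ j * r $ i) = 1)"
  using assms
  unfolding balancing_def doubly_stochastic_def diag_matrix_scaling_nth pos_vector_def
    pos_matrix_def sum_distrib_left
  by (auto simp: mult_ac less_imp_le)

lemma sinkhorn_existence:
  fixes Y :: "real ^ 'n ^ 'n"
  assumes Y: "pos_matrix Y"
  shows "\<exists>r c. balancing Y r c"
proof -
  define S where "S = {x :: real ^ 'n. (\<forall>i. 0 \<le> x $ i) \<and> (\<Sum>i\<in>UNIV. x $ i) = 1}"
  define R where "R x i = (\<Sum>j\<in>UNIV. Y $ i $ j * x $ j)" for x :: "real ^ 'n" and i
  define C where "C x j = (\<Sum>i\<in>UNIV. Y $ i $ j * (1 / R x i))" for x j
  define N where "N x = (\<Sum>j\<in>UNIV. 1 / C x j)" for x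
  define T where "T x = (\<chi> j. (1 / C x j) / N x)" for x
  have Y': "0 < Y $ i $ j" for i j
    using Y by (simp add: pos_matrix_def)
  have R: "0 < R x i" if "x \<in> S" for x i
  proof -
    obtain k where "x $ k \<noteq> 0"
      using \<open>x \<in> S\<close> unfolding S_def
      by (metis (mono_tags, lifting) mem_Collect_eq sum.neutral zero_neq_one)
    with \<open>x \<in> S\<close> have "0 < Y $ i $ k * x $ k"
      using Y' by (simp add: S_def order_less_le)
    then show ?thesis
      unfolding R_def using \<open>x \<in> S\<close> Y'
      by (intro sum_pos2[of _ k]) (auto simp: S_def less_imp_le)
  qed
  have C: "0 < C x j" if "x \<in> S" for x j
    unfolding C_def using R[OF that] Y' by (intro sum_pos) auto
  have N: "0 < N x" if "x \<in> S" for x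
    unfolding N_def using C[OF that] by (intro sum_pos) auto
  have "compact S"
  proof -
    have "norm x \<le> 1" if "x \<in> S" for x
      using that norm_le_l1_cart[of x] by (simp add: S_def)
    then have "bounded S"
      by (auto simp: bounded_iff)
    moreover have "closed S"
      unfolding S_def Collect_conj_eq Collect_all_eq
      by (intro closed_Int closed_INT closed_Collect_le closed_Collect_eq ballI
          continuous_intros)
    ultimately show ?thesis
      by (simp add: compact_eq_bounded_closed)
  qed
  moreover have "convex S"
    unfolding convex_def S_def by (simp add: sum.distrib flip: sum_distrib_left)
  moreover have "S \<noteq> {}"
  proof -
    have "(\<chi> i. 1 / real CARD('n)) \<in> S"
      by (simp add: S_def)
    then show ?thesis by blast
  qed
  moreover have "continuous_on S T"
  proof -
    have cR: "continuous_on S (\<lambda>x. R x i)" for i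
      unfolding R_def by (intro continuous_intros)
    have cC: "continuous_on S (\<lambda>x. C x j)" for j
      unfolding C_def using R by (intro continuous_intros cR) (metis less_irrefl)
    have cN: "continuous_on S N"
      unfolding N_def using C by (intro continuous_intros cC) (metis less_irrefl)
    show ?thesis
      unfolding T_def using C N
      by (intro continuous_intros cC cN) (metis less_irrefl)+
  qed
  moreover have "T \<in> S \<rightarrow> S"
  proof
    fix x assume x: "x \<in> S"
    have "(\<Sum>j\<in>UNIV. T x $ j) = N x / N x"
      by (simp add: T_def N_def sum_divide_distrib del: divide_self_if)
    then show "T x \<in> S"
      using C[OF x] N[OF x] by (simp add: S_def T_def less_imp_le)
  qed
  ultimately obtain x where x: "x \<in> S" and fp: "T x = x"
    by (rule brouwer)
  define l where "l = 1 / N x"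
  have xC: "x $ j * C x j = l" for j
  proof -
    have "x $ j = (1 / C x j) / N x"
      using fp by (metis T_def vec_lambda_beta)
    then show ?thesis
      using C[OF x, of j] by (simp add: l_def field_simps)
  qed
  have xpos: "0 < x $ j" for j
  proof -
    have "0 < T x $ j"
      using C[OF x] N[OF x] by (simp add: T_def)
    then show ?thesis by (simp add: fp)
  qed
  have "real CARD('n) * l = (\<Sum>j\<in>UNIV. x $ j * C x j)"
    by (simp add: xC)
  also have "\<dots> = (\<Sum>j\<in>UNIV. \<Sum>i\<in>UNIV. Y $ i $ j * x $ j / R x i)"
    by (simp add: C_def sum_distrib_left mult_ac)
  also have "\<dots> = (\<Sum>i\<in>UNIV. \<Sum>j\<in>UNIV. Y $ i $ j * x $ j / R x i)"
    by (rule sum.swap)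
  also have "\<dots> = (\<Sum>i\<in>UNIV. R x i / R x i)"
    unfolding R_def sum_divide_distrib[symmetric] ..
  also have "\<dots> = real CARD('n)"
    using R[OF x] by (simp add: less_imp_neq[symmetric])
  finally have "l = 1"
    by simp
  have "1 / R x i * (\<Sum>j\<in>UNIV. Y $ i $ j * x $ j) = 1" for i
    using R[OF x, of i] by (simp flip: R_def)
  moreover have "x $ j * (\<Sum>i\<in>UNIV. Y $ i $ j * (1 / R x i)) = 1" for j
    using xC[of j] \<open>l = 1\<close> by (simp only: C_def)
  ultimately have "balancing Y (\<chi> i. 1 / R x i) x"
    unfolding balancing_iff[OF Y] pos_vector_def vec_lambda_beta
    using R[OF x] xpos by (intro conjI allI) (assumption | simp only: zero_less_divide_1_iff)+
  then show ?thesis by blast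
qed

lemma sinkhorn_uniqueness:
  fixes Y :: "real ^ 'n ^ 'n"
  assumes Y: "pos_matrix Y" and 1: "balancing Y r c" and 2: "balancing Y r' c'"
  shows "diag_matrix r ** Y ** diag_matrix c = diag_matrix r' ** Y ** diag_matrix c'"
proof -
  define A where "A i j = r $ i * Y $ i $ j * c $ j" for i j
  define a where "a i = r' $ i / r $ i" for i
  define b where "b j = c' $ j / c $ j" for j
  have pos: "0 < r $ i" "0 < c $ i" "0 < r' $ i" "0 < c' $ i" "0 < Y $ i $ j" for i j
    using Y 1 2 by (auto simp: balancing_def pos_vector_def pos_matrix_def)
  have A: "0 < A i j" "(\<Sum>j\<in>UNIV. A i j) = 1" "(\<Sum>i\<in>UNIV. A i j) = 1" for i j
    using pos 1
    by (auto simp: A_def balancing_def doubly_stochastic_def diag_matrix_scaling_nth)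
  have ab: "0 < a i" "0 < b i" for i
    using pos by (auto simp: a_def b_def)
  have B: "a i * A i j * b j = r' $ i * Y $ i $ j * c' $ j" for i j
    using pos[of i] pos[of j] by (simp add: a_def b_def A_def)
  have "(\<Sum>j\<in>UNIV. a i * A i j * b j) = 1" for i
    unfolding B using 2 by (simp add: balancing_def doubly_stochastic_def diag_matrix_scaling_nth)
  then have row: "a i * (\<Sum>j\<in>UNIV. A i j * b j) = 1" for i
    by (simp add: sum_distrib_left mult.assoc)
  have "(\<Sum>i\<in>UNIV. a i * A i j * b j) = 1" for j
    unfolding B using 2 by (simp add: balancing_def doubly_stochastic_def diag_matrix_scaling_nth)
  then have col: "(\<Sum>i\<in>UNIV. A i j * a i) * b j = 1" for j
    unfolding sum_distrib_right by (simp add: mult_ac)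
  obtain p where p: "a i \<le> a p" for i
  proof -
    have "Max (range a) \<in> range a" by (intro Max_in) auto
    then obtain p where "Max (range a) = a p" ..
    then have "a p = Max (range a)" by (rule sym)
    then show ?thesis using that[of p] by auto
  qed
  have blow: "1 \<le> a p * b j" for j
  proof -
    have "(\<Sum>i\<in>UNIV. A i j * a i) \<le> (\<Sum>i\<in>UNIV. A i j * a p)"
      using A p by (intro sum_mono mult_left_mono) (auto simp: less_imp_le)
    also have "\<dots> = a p"
      using A by (simp flip: sum_distrib_right)
    finally show ?thesis
      using col[of j] ab(2)[of j] by (metis less_imp_le mult_right_mono)
  qed
  have "(\<Sum>j\<in>UNIV. A p j * (a p * b j - 1)) = a p * (\<Sum>j\<in>UNIV. A p j * b j) - (\<Sum>j\<in>UNIV. A p j)"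
    by (simp add: algebra_simps sum_subtractf sum_distrib_left)
  also have "\<dots> = 0"
    using row A by simp
  finally have "\<forall>j\<in>UNIV. A p j * (a p * b j - 1) = 0"
    using blow A by (subst (asm) sum_nonneg_eq_0_iff) (auto simp: less_imp_le)
  then have b1: "a p * b j = 1" for j
    using A(1)[of p j] by (metis UNIV_I eq_iff_diff_eq_0 less_irrefl mult_eq_0_iff)
  have "a i * b j = 1" for i j
  proof -
    have b2: "b j' = b j" for j'
      using b1 ab(1)[of p] by (metis less_irrefl mult_left_cancel)
    have "(\<Sum>k\<in>UNIV. A i k * b k) = (\<Sum>k\<in>UNIV. A i k * b j)"
      by (intro sum.cong refl) (metis b2)
    also have "\<dots> = b j"
      using A by (simp flip: sum_distrib_right)
    finally show ?thesis
      using row[of i] by simp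
  qed
  then have "a i * A i j * b j = A i j" for i j
    by (metis mult.assoc mult.commute mult_1)
  then show ?thesis
    by (simp add: vec_eq_iff diag_matrix_scaling_nth B flip: A_def)
qed

theorem sinkhorn_theorem:
  assumes "pos_matrix Y"
  shows "\<exists>!M. \<exists>r c. balancing Y r c \<and> M = diag_matrix r ** Y ** diag_matrix c"
  using sinkhorn_existence[OF assms] sinkhorn_uniqueness[OF assms] by blast

end

theory Submission
  imports Defs
begin

text \<open>Hadamard multiplication by \<open>u \<otimes>\<^sub>v v\<close> is itself a diagonal
  scaling, by \<open>u\<close> on the rows and \<open>v\<close> on the columns. Dividing balancing
  vectors of \<open>X\<close> entrywise by \<open>u\<close> and \<open>v\<close> undoes it, so the
  new matrix is balanced to the very same doubly stochastic matrix
  (\<open>diag_scaling_hadamard_outer_product\<close>). Since the balanced matrix is unique, any one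
  balancing pair determines the value of \<open>sinkhorn\<close>
  (\<open>sinkhorn_eq_if_balancing\<close>), and both sides agree.\<close>

lemma sinkhorn_eq_if_balancing:
  assumes "pos_matrix Y" and "balancing Y r c"
  shows "sinkhorn Y = diag_matrix r ** Y ** diag_matrix c"
  unfolding sinkhorn_def using assms sinkhorn_theorem by (intro the1_equality) blast+

lemma pos_matrix_hadamard_outer_product:
  assumes "pos_matrix X" and "pos_vector u" and "pos_vector v"
  shows "pos_matrix (X \<circ>\<^sub>H (u \<otimes>\<^sub>v v))"
  using assms
  by (simp add: pos_matrix_def pos_vector_def hadamard_product_def outer_product_def)

text \<open>In each entry the factors \<open>u $ i\<close> and \<open>v $ j\<close> cancel against
  the divisors, which positivity keeps nonzero.\<close>

lemma diag_scaling_hadamard_outer_product: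
  fixes X :: "real ^ 'n ^ 'n"
  assumes "pos_vector u" and "pos_vector v"
  shows "diag_matrix (\<chi> i. r $ i / u $ i) ** (X \<circ>\<^sub>H (u \<otimes>\<^sub>v v)) ** diag_matrix (\<chi> j. c $ j / v $ j)
    = diag_matrix r ** X ** diag_matrix c"
proof -
  have "u $ i \<noteq> 0" "v $ i \<noteq> 0" for i
    using assms by (simp_all add: pos_vector_def less_imp_neq[symmetric])
  then show ?thesis
    by (simp add: vec_eq_iff diag_matrix_scaling_nth hadamard_product_def outer_product_def)
qed

theorem lemma1:
  fixes X :: "real ^ 'n ^ 'n" and u v :: "real ^ 'n"
  assumes "pos_matrix X" and "pos_vector u" and "pos_vector v"
  shows "sinkhorn X = sinkhorn (X \<circ>\<^sub>H (u \<otimes>\<^sub>v v))"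
proof -
  obtain r c where rc: "balancing X r c"
    using sinkhorn_existence assms(1) by blast
  define r' where "r' = (\<chi> i. r $ i / u $ i)"
  define c' where "c' = (\<chi> j. c $ j / v $ j)"
  have eq: "diag_matrix r' ** (X \<circ>\<^sub>H (u \<otimes>\<^sub>v v)) ** diag_matrix c'
      = diag_matrix r ** X ** diag_matrix c"
    unfolding r'_def c'_def by (rule diag_scaling_hadamard_outer_product[OF assms(2,3)])
  \<comment> \<open>Double stochasticity transfers through \<open>eq\<close>, as the scaled matrices
    coincide; what remains is that quotients of positive entries are positive.\<close>
  have "balancing (X \<circ>\<^sub>H (u \<otimes>\<^sub>v v)) r' c'"
    using rc assms(2,3) by (simp add: balancing_def eq) (simp add: pos_vector_def r'_def c'_def)
  then have "sinkhorn (X \<circ>\<^sub>H (u \<otimes>\<^sub>v v)) = diag_matrix r ** X ** diag_matrix c"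
    using sinkhorn_eq_if_balancing pos_matrix_hadamard_outer_product[OF assms] eq by metis
  then show ?thesis
    using sinkhorn_eq_if_balancing[OF assms(1) rc] by simp
qed

end
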